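(* Fix a permutation $p:\mathbb N\to\mathbb N$, $n\mapsto n'$. Let $s\in\{1,2,\dots\}$. If $w=(w_n)\in\prod_{n=1}^\infty\Delta$ and $\sum_{n>0}n^{s-1}|w_n|<\infty$, then for $z\in S^1$ the limit $$\sigma(p,w;z)=z\prod_{n=1}^\infty\frac{(1+\bar w_{n'}\sigma_{n-1}(z)^{-n'})^{1/n'}}{(1+w_{n'}\sigma_{n-1}(z)^{n'})^{1/n'}}$$ exists, and $\sigma(z)=\sigma(p,w;z)$ is a $C^s$ homeomorphism of $S^1$ with $C^s$ inverse.
   Context: $\mathbb N=\{1,2,\dots\}$, $\Delta=\{w\in\mathbb C:|w|<1\}$, $S^1=\{|z|=1\}$. For $n\ge1$ and $w_n\in\Delta$, $\phi_n(w_n;z)=z\,(1+\bar w_nz^{-n})^{1/n}/(1+w_nz^n)^{1/n}$, $|z|=1$ (principal branches), an orientation preserving diffeomorphism of $S^1$. For $N\ge 0$, $\sigma_N=\phi_{N'}(w_{N'})\circ\cdots\circ\phi_{1'}(w_{1'})$ (with $\sigma_0=\mathrm{id}$), so that $\sigma_N(z)=z\prod_{n=1}^N\frac{(1+\bar w_{n'}\sigma_{n-1}(z)^{-n'})^{1/n'}}{(1+w_{n'}\sigma_{n-1}(z)^{n'})^{1/n'}}$; thus $\sigma(p,w;z)=\lim_{N\to\infty}\sigma_N(z)$. Homeomorphisms are orientation preserving. *)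

theory Defs
  imports "HOL-Analysis.Analysis"
begin

definition phi_factor :: "nat \<Rightarrow> complex \<Rightarrow> complex \<Rightarrow> complex" where
  "phi_factor n w z =
     (1 + cnj w * z powi (- int n)) powr (1 / of_nat n) / (1 + w * z ^ n) powr (1 / of_nat n)"

definition phi :: "nat \<Rightarrow> complex \<Rightarrow> complex \<Rightarrow> complex" where
  "phi n w z = z * phi_factor n w z"

text \<open>Positive integers are represented by \<^typ>\<open>nat\<close>; the values \<open>p 0\<close> and \<open>w 0\<close> are never used.\<close>

primrec sigma_part :: "(nat \<Rightarrow> nat) \<Rightarrow> (nat \<Rightarrow> complex) \<Rightarrow> nat \<Rightarrow> complex \<Rightarrow> complex" where
  "sigma_part p w 0 = id"
| "sigma_part p w (Suc N) = phi (p (Suc N)) (w (p (Suc N))) \<circ> sigma_part p w N"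

text \<open>\<open>sigma_factor p w n\<close> is the factor with index \<open>n \<ge> 1\<close> of the infinite product.\<close>

definition sigma_factor :: "(nat \<Rightarrow> nat) \<Rightarrow> (nat \<Rightarrow> complex) \<Rightarrow> nat \<Rightarrow> complex \<Rightarrow> complex" where
  "sigma_factor p w n z = phi_factor (p n) (w (p n)) (sigma_part p w (n - 1) z)"

definition sigma_lim :: "(nat \<Rightarrow> nat) \<Rightarrow> (nat \<Rightarrow> complex) \<Rightarrow> complex \<Rightarrow> complex" where
  "sigma_lim p w z = z * (\<Prod>n. sigma_factor p w (Suc n) z)"

definition Ck_real :: "nat \<Rightarrow> (real \<Rightarrow> 'a::real_normed_vector) \<Rightarrow> bool" where
  "Ck_real k f \<longleftrightarrow>
     (\<exists>D. D 0 = f \<and>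
          (\<forall>j<k. \<forall>t. (D j has_vector_derivative D (Suc j) t) (at t)) \<and>
          continuous_on UNIV (D k))"

text \<open>Since \<^const>\<open>cis\<close> is a smooth covering of the unit circle by the real line, a map from the
  circle to the plane is \<open>C\<^sup>k\<close> iff it is so in the angular coordinate.\<close>

definition circle_Ck :: "nat \<Rightarrow> (complex \<Rightarrow> complex) \<Rightarrow> bool" where
  "circle_Ck k f \<longleftrightarrow> Ck_real k (\<lambda>t. f (cis t))"

text \<open>Orientation preservation of a circle homeomorphism: it has an increasing lift of degree one.\<close>

definition circle_orientation_preserving :: "(complex \<Rightarrow> complex) \<Rightarrow> bool" where
  "circle_orientation_preserving f \<longleftrightarrow>
     (\<exists>F::real \<Rightarrow> real. continuous_on UNIV F \<and> strict_mono F \<and>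
        (\<forall>t. F (t + 2 * pi) = F t + 2 * pi) \<and> (\<forall>t. f (cis t) = cis (F t)))"

end

theory Submission
  imports Defs
begin

text \<open>Everything is done in the angular coordinate. On the circle one has
\<open>\<phi>\<^sub>n(w; cis t) = cis (\<Phi>\<^sub>n(t))\<close> with \<open>\<Phi>\<^sub>n(t) = t - (2/n) Im Ln(1 + w cis(nt))\<close>, and
the derivative of \<open>\<Phi>\<^sub>n\<close> is a Poisson kernel:
\<open>\<Phi>\<^sub>n'(t) = (1 - |w|^2) / |1 + w cis(nt)|^2 = exp (h\<^sub>n(t))\<close>, where \<open>h\<^sub>n\<close> is of size \<open>O(|w|)\<close>
and each differentiation of \<open>h\<^sub>n\<close> costs one factor \<open>n\<close>.

Let \<open>F\<^sub>N\<close> be the composition of the first \<open>N\<close> lifts. (Indices are written here as if \<open>p\<close> were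
the identity; all series below converge absolutely, so that \<open>p\<close> only rearranges them.) Displacements are \<open>O(|w\<^sub>n|)\<close>, so \<open>F\<^sub>N\<close>
converges uniformly; exponentiating gives the infinite product. For smoothness the point is
that the logarithm of \<open>F\<^sub>N'\<close> is the sum of the functions \<open>h\<^sub>n \<circ> F\<^bsub>n-1\<^esub>\<close>, so that the chain
rule, which multiplies, turns into a series. If all the \<open>F\<^sub>N'\<close> have derivatives up to order \<open>k\<close>
bounded independently of \<open>N\<close>, then the \<open>n\<close>-th term of that series is of size
\<open>O(n^(k+1) |w\<^sub>n|)\<close> in \<open>C^(k+1)\<close>; as long as \<open>k + 1 \<le> s - 1\<close> this is summable, and the \<open>F\<^sub>N'\<close> are
bounded in \<open>C^(k+1)\<close>. Starting from order \<open>0\<close> one reaches order \<open>s - 1\<close>: this is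
\<open>Ck_bounded_log_deriv_term\<close>. In the limit \<open>F' = exp S\<close> with \<open>S\<close> of class \<open>C^(s-1)\<close>, hence
\<open>F\<close> is of class \<open>C^s\<close> and strictly increasing.

The inverse \<open>G\<close> of \<open>F\<close> solves \<open>G' = exp (- S(G))\<close>, an equation in which every order of
smoothness of \<open>G\<close> up to \<open>s - 1\<close> produces one more. Finally \<open>F\<close> and \<open>G\<close> commute with the
translation by \<open>2\<pi>\<close>, so both descend to the circle (\<open>circle_diffeo_if_lift\<close>).\<close>

section \<open>Functions with uniformly bounded derivatives\<close>

text \<open>The common bound \<open>C\<close> on the function and its first \<open>k\<close> derivatives plays the part of a \<open>C^k\<close>
norm. Peeling off one derivative at a time lets products, compositions and differential
equations be treated by induction on \<open>k\<close>, without Leibniz or Faa di Bruno formulas.\<close>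

primrec Ck_bounded :: "nat \<Rightarrow> real \<Rightarrow> (real \<Rightarrow> 'a::real_normed_vector) \<Rightarrow> bool" where
  "Ck_bounded 0 C f \<longleftrightarrow> continuous_on UNIV f \<and> (\<forall>t. norm (f t) \<le> C)"
| "Ck_bounded (Suc k) C f \<longleftrightarrow> (\<forall>t. norm (f t) \<le> C) \<and>
     (\<exists>f'. (\<forall>t. (f has_vector_derivative f' t) (at t)) \<and> Ck_bounded k C f')"

lemma Ck_boundedD: "Ck_bounded k C f \<Longrightarrow> norm (f t) \<le> C"
  by (cases k) auto

lemma Ck_bounded_nonneg: "Ck_bounded k C f \<Longrightarrow> 0 \<le> C"
  using Ck_boundedD norm_ge_zero order_trans by blast

lemma Ck_boundedSucI:
  assumes "\<And>t. norm (f t) \<le> C" "\<And>t. (f has_vector_derivative f' t) (at t)" "Ck_bounded k C f'"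
  shows "Ck_bounded (Suc k) C f"
  using assms by auto

lemma Ck_boundedSucE:
  assumes "Ck_bounded (Suc k) C f"
  obtains f' where "\<And>t. (f has_vector_derivative f' t) (at t)" "Ck_bounded k C f'"
  using assms by auto

lemma continuous_on_UNIV_if_vector_derivative:
  "(\<And>t. (f has_vector_derivative f' t) (at t)) \<Longrightarrow> continuous_on UNIV f"
  by (meson continuous_at_imp_continuous_on has_vector_derivative_continuous)

lemma Ck_bounded_weaken: "Ck_bounded k C f \<Longrightarrow> C \<le> D \<Longrightarrow> Ck_bounded k D f"
proof (induction k arbitrary: f)
  case 0
  then show ?case by (auto intro: order_trans)
next
  case (Suc k)
  then show ?case by (auto intro: order_trans)
qed

lemma Ck_bounded_SucD: "Ck_bounded (Suc k) C f \<Longrightarrow> Ck_bounded k C f"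
proof (induction k arbitrary: f)
  case 0
  then show ?case using continuous_on_UNIV_if_vector_derivative by auto
next
  case (Suc k)
  then show ?case by (metis Ck_bounded.simps(2))
qed

lemma Ck_bounded_le: "j \<le> k \<Longrightarrow> Ck_bounded k C f \<Longrightarrow> Ck_bounded j C f"
  by (induction rule: inc_induct) (auto dest: Ck_bounded_SucD simp del: Ck_bounded.simps)

lemma Ck_bounded_pred: "Ck_bounded k C f \<Longrightarrow> Ck_bounded (k - 1) C f"
  by (erule Ck_bounded_le[rotated]) simp

lemma Ck_bounded_continuous: "Ck_bounded k C f \<Longrightarrow> continuous_on UNIV f"
  by (induction k) (auto dest: Ck_bounded_SucD simp del: Ck_bounded.simps(2))

lemma Ck_bounded_imp_Ck_real: "Ck_bounded k C f \<Longrightarrow> Ck_real k f"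
proof (induction k arbitrary: f)
  case 0
  then show ?case unfolding Ck_real_def by (intro exI[of _ "\<lambda>_. f"]) auto
next
  case (Suc k)
  obtain f' where f': "\<And>t. (f has_vector_derivative f' t) (at t)" "Ck_bounded k C f'"
    using Suc.prems by (rule Ck_boundedSucE) blast
  from Suc.IH[OF f'(2)] obtain D where D: "D 0 = f'"
    "\<forall>j<k. \<forall>t. (D j has_vector_derivative D (Suc j) t) (at t)" "continuous_on UNIV (D k)"
    unfolding Ck_real_def by blast
  show ?case unfolding Ck_real_def
    by (intro exI[of _ "case_nat f D"]) (use D f'(1) in \<open>auto split: nat.splits\<close>)
qed

lemma Ck_bounded_const: "norm c \<le> C \<Longrightarrow> Ck_bounded k C (\<lambda>_. c)"
proof (induction k arbitrary: c)
  case (Suc k)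
  then show ?case using norm_ge_zero[of c]
    by (intro Ck_boundedSucI[of _ _ "\<lambda>_. 0"] Suc.IH) (auto simp del: norm_ge_zero)
qed auto

lemma Ck_bounded_add:
  "Ck_bounded k C f \<Longrightarrow> Ck_bounded k D g \<Longrightarrow> Ck_bounded k (C + D) (\<lambda>t. f t + g t)"
proof (induction k arbitrary: f g)
  case 0
  then show ?case by (auto intro!: continuous_intros norm_triangle_le add_mono)
next
  case (Suc k)
  obtain f' where f': "\<And>t. (f has_vector_derivative f' t) (at t)" "Ck_bounded k C f'"
    using Suc.prems(1) by (rule Ck_boundedSucE) blast
  obtain g' where g': "\<And>t. (g has_vector_derivative g' t) (at t)" "Ck_bounded k D g'"
    using Suc.prems(2) by (rule Ck_boundedSucE) blast
  show ?case
    using Suc.prems[THEN Ck_boundedD]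
    by (intro Ck_boundedSucI[of _ _ "\<lambda>t. f' t + g' t"] Suc.IH f' g' has_vector_derivative_add)
      (auto intro!: norm_triangle_le add_mono)
qed

lemma Ck_bounded_sum:
  "(\<And>i. Ck_bounded k (c i) (f i)) \<Longrightarrow> Ck_bounded k (\<Sum>i<(n::nat). c i) (\<lambda>t. \<Sum>i<n. f i t)"
  by (induction n) (auto intro: Ck_bounded_const Ck_bounded_add)

lemma Ck_bounded_linear:
  assumes "bounded_linear L" and L: "\<And>x. norm (L x) \<le> c * norm x" and "0 \<le> c"
  shows "Ck_bounded k C f \<Longrightarrow> Ck_bounded k (c * C) (\<lambda>t. L (f t))"
proof (induction k arbitrary: f)
  case 0
  then show ?case
    using assms(3) by (auto intro!: bounded_linear.continuous_on[OF assms(1)] order_trans[OF L] mult_left_mono)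
next
  case (Suc k)
  obtain f' where f': "\<And>t. (f has_vector_derivative f' t) (at t)" "Ck_bounded k C f'"
    using Suc.prems by (rule Ck_boundedSucE) blast
  show ?case
    using Suc.prems[THEN Ck_boundedD] assms(3)
    by (intro Ck_boundedSucI[of _ _ "\<lambda>t. L (f' t)"] Suc.IH f' bounded_linear.has_vector_derivative[OF assms(1)])
      (auto intro!: order_trans[OF L] mult_left_mono)
qed

text \<open>Both the product of scalars with vectors and the product of an algebra are needed: the former
in the chain rule, the latter for complex exponentials.\<close>

lemma Ck_bounded_bilinear:
  assumes "bounded_bilinear mul" and P: "\<And>a b. norm (mul a b) \<le> norm a * norm b"
  shows "Ck_bounded k C f \<Longrightarrow> Ck_bounded k D g
    \<Longrightarrow> Ck_bounded k (2 ^ k * (C * D)) (\<lambda>t. mul (f t) (g t))"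
proof (induction k arbitrary: f g)
  case 0
  then show ?case
    using Ck_bounded_nonneg[of 0 C f]
    by (auto intro!: bounded_bilinear.continuous_on[OF assms(1)] order_trans[OF P] mult_mono)
next
  case (Suc k)
  obtain f' where f': "\<And>t. (f has_vector_derivative f' t) (at t)" "Ck_bounded k C f'"
    using Suc.prems(1) by (rule Ck_boundedSucE) blast
  obtain g' where g': "\<And>t. (g has_vector_derivative g' t) (at t)" "Ck_bounded k D g'"
    using Suc.prems(2) by (rule Ck_boundedSucE) blast
  have C: "0 \<le> C" "0 \<le> D" using Suc.prems[THEN Ck_bounded_nonneg] by auto
  have "norm (mul (f t) (g t)) \<le> 2 ^ Suc k * (C * D)" for t
  proof -
    have "norm (mul (f t) (g t)) \<le> C * D"
      using Suc.prems[THEN Ck_boundedD] C by (intro order_trans[OF P] mult_mono) auto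
    also have "C * D \<le> 2 ^ Suc k * (C * D)"
      using C mult_right_mono[of 1 "2 ^ Suc k" "C * D"] one_le_power[of "2::real" "Suc k"] by auto
    finally show ?thesis .
  qed
  moreover have "Ck_bounded k (2 ^ k * (C * D) + 2 ^ k * (C * D))
      (\<lambda>t. mul (f t) (g' t) + mul (f' t) (g t))"
    using Suc.prems[THEN Ck_bounded_SucD] f' g' by (intro Ck_bounded_add Suc.IH)
  ultimately show ?case
    by (intro Ck_boundedSucI[of _ _ "\<lambda>t. mul (f t) (g' t) + mul (f' t) (g t)"]
        bounded_bilinear.has_vector_derivative[OF assms(1)] f' g') (auto simp: algebra_simps)
qed

lemma Ck_bounded_scaleR:
  "Ck_bounded k C f \<Longrightarrow> Ck_bounded k D g \<Longrightarrow> Ck_bounded k (2 ^ k * (C * D)) (\<lambda>t. f t *\<^sub>R g t)"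
  by (rule Ck_bounded_bilinear[OF bounded_bilinear_scaleR]) auto

lemma Ck_bounded_mult:
  fixes f g :: "real \<Rightarrow> 'a::real_normed_algebra"
  shows "Ck_bounded k C f \<Longrightarrow> Ck_bounded k D g \<Longrightarrow> Ck_bounded k (2 ^ k * (C * D)) (\<lambda>t. f t * g t)"
  by (rule Ck_bounded_bilinear[OF bounded_bilinear_mult]) (auto simp: norm_mult_ineq)

lemma has_vector_derivative_compose_real:
  assumes "(f has_vector_derivative f') (at t)" "(h has_vector_derivative h') (at (f t))"
  shows "((\<lambda>t. h (f t)) has_vector_derivative (f' *\<^sub>R h')) (at t)"
  using vector_diff_chain_at[OF assms] by (simp add: o_def)

text \<open>The constant depends on \<open>k\<close> and on the bound for the derivative of the inner function only, and
the estimate is linear in the outer function. Linearity is what allows the estimates to be summed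
over the factors of an infinite composition. The inner function itself may be unbounded,
which is needed for lifts of circle maps. For \<open>k = 0\<close> the order \<open>k - 1\<close> truncates to \<open>0\<close>.\<close>

lemma Ck_bounded_compose:
  obtains K where "0 \<le> K"
    "\<And>(h :: real \<Rightarrow> 'a::real_normed_vector) (f :: real \<Rightarrow> real) f' C. Ck_bounded k C h \<Longrightarrow>
      (\<And>t. (f has_vector_derivative f' t) (at t)) \<Longrightarrow> Ck_bounded (k - 1) M f' \<Longrightarrow>
      Ck_bounded k (K * C) (\<lambda>t. h (f t))"
proof -
  have "\<exists>K\<ge>0. \<forall>(h :: real \<Rightarrow> 'a) (f :: real \<Rightarrow> real) f' C. Ck_bounded k C h \<longrightarrow>
      (\<forall>t. (f has_vector_derivative f' t) (at t)) \<longrightarrow> Ck_bounded (k - 1) M f' \<longrightarrow>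
      Ck_bounded k (K * C) (\<lambda>t. h (f t))"
  proof (induction k)
    case 0
    show ?case
    proof (intro exI[of _ 1] conjI allI impI)
      fix h :: "real \<Rightarrow> 'a" and f f' :: "real \<Rightarrow> real" and C
      assume "Ck_bounded 0 C h" "\<forall>t. (f has_vector_derivative f' t) (at t)"
      then show "Ck_bounded 0 (1 * C) (\<lambda>t. h (f t))"
        using continuous_on_UNIV_if_vector_derivative[of f f']
        by (auto intro!: continuous_on_compose2[of UNIV h])
    qed auto
  next
    case (Suc k)
    then obtain K where K: "0 \<le> K" "\<And>(h :: real \<Rightarrow> 'a) (f :: real \<Rightarrow> real) f' C. Ck_bounded k C h \<Longrightarrow>
      (\<And>t. (f has_vector_derivative f' t) (at t)) \<Longrightarrow> Ck_bounded (k - 1) M f' \<Longrightarrow>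
      Ck_bounded k (K * C) (\<lambda>t. h (f t))"
      by blast
    define K' where "K' = 1 + 2 ^ k * (\<bar>M\<bar> * K)"
    have K': "1 \<le> K'" using K(1) by (simp add: K'_def)
    show ?case
    proof (intro exI[of _ K'] conjI allI impI)
      show "0 \<le> K'" using K' by simp
      fix h :: "real \<Rightarrow> 'a" and f f' :: "real \<Rightarrow> real" and C
      assume h: "Ck_bounded (Suc k) C h" and f: "\<forall>t. (f has_vector_derivative f' t) (at t)"
        and f': "Ck_bounded (Suc k - 1) M f'"
      have C: "0 \<le> C" "0 \<le> M" using h f' Ck_bounded_nonneg by blast+
      obtain h' where h': "\<And>t. (h has_vector_derivative h' t) (at t)" "Ck_bounded k C h'"
        using h by (rule Ck_boundedSucE) blast
      have "Ck_bounded k (K * C) (\<lambda>t. h' (f t))"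
        using f f' Ck_bounded_pred by (intro K(2)[OF h'(2)]) auto
      then have "Ck_bounded k (2 ^ k * (M * (K * C))) (\<lambda>t. f' t *\<^sub>R h' (f t))"
        using f' by (intro Ck_bounded_scaleR) auto
      moreover have "2 ^ k * (M * (K * C)) \<le> K' * C" "C \<le> K' * C"
        using C K' mult_right_mono[of 1 K' C] by (auto simp: K'_def algebra_simps)
      ultimately show "Ck_bounded (Suc k) (K' * C) (\<lambda>t. h (f t))"
        using Ck_boundedD[OF h] f h'(1)
        by (intro Ck_boundedSucI[of _ _ "\<lambda>t. f' t *\<^sub>R h' (f t)"] has_vector_derivative_compose_real)
          (auto intro: Ck_bounded_weaken order_trans)
    qed
  qed
  then show ?thesis using that by blast
qed

text \<open>Better than the general composition estimate: the growth in \<open>n\<close> is exactly \<open>n^k\<close>, the weight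
in the summability condition.\<close>

lemma Ck_bounded_dilate:
  assumes "1 \<le> n"
  shows "Ck_bounded k C h \<Longrightarrow> Ck_bounded k (n ^ k * C) (\<lambda>t. h (n * t))"
proof (induction k arbitrary: h)
  case 0
  then show ?case by (auto intro!: continuous_on_compose2[of UNIV h] continuous_intros)
next
  case (Suc k)
  obtain h' where h': "\<And>t. (h has_vector_derivative h' t) (at t)" "Ck_bounded k C h'"
    using Suc.prems by (rule Ck_boundedSucE) blast
  have C: "0 \<le> C" using Suc.prems Ck_bounded_nonneg by blast
  have "((\<lambda>t. n * t) has_vector_derivative n) (at t)" for t
    by (auto intro!: derivative_eq_intros simp flip: has_real_derivative_iff_has_vector_derivative)
  moreover have "Ck_bounded k (n * (n ^ k * C)) (\<lambda>t. n *\<^sub>R h' (n * t))"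
    using assms by (intro Ck_bounded_linear[OF bounded_linear_scaleR_right] Suc.IH h') auto
  moreover have "C \<le> n ^ Suc k * C"
    using C mult_right_mono[of 1 "n ^ Suc k" C] one_le_power[OF assms, of "Suc k"] by auto
  ultimately show ?case
    using Ck_boundedD[OF Suc.prems]
    by (intro Ck_boundedSucI[of _ _ "\<lambda>t. n *\<^sub>R h' (n * t)"] has_vector_derivative_compose_real h')
      (auto simp: mult.assoc intro: order_trans)
qed

text \<open>A solution of \<open>E' = A E\<close> is one order smoother than \<open>A\<close>: differentiate the equation. The estimate is
again linear in the size of \<open>E\<close>. It covers \<open>exp \<circ> f\<close> with \<open>A = f'\<close>, \<open>cis \<circ> F\<close> with \<open>A = \<i> F'\<close>,
and the building block \<open>circle_frac\<close>.\<close>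

lemma Ck_bounded_linear_ode:
  obtains D where "0 \<le> D"
    "\<And>(E :: real \<Rightarrow> 'a::real_normed_algebra) A M. (\<And>t. (E has_vector_derivative A t * E t) (at t)) \<Longrightarrow>
      (\<And>t. norm (E t) \<le> M) \<Longrightarrow> Ck_bounded (k - 1) C A \<Longrightarrow> Ck_bounded k (D * M) E"
proof -
  have "\<exists>D\<ge>0. \<forall>(E :: real \<Rightarrow> 'a) A M. (\<forall>t. (E has_vector_derivative A t * E t) (at t)) \<longrightarrow>
      (\<forall>t. norm (E t) \<le> M) \<longrightarrow> Ck_bounded (k - 1) C A \<longrightarrow> Ck_bounded k (D * M) E"
  proof (induction k)
    case 0
    show ?case
      using continuous_on_UNIV_if_vector_derivative by (intro exI[of _ 1]) fastforce
  next
    case (Suc k)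
    then obtain D where D: "0 \<le> D" "\<And>(E :: real \<Rightarrow> 'a) A M.
      (\<And>t. (E has_vector_derivative A t * E t) (at t)) \<Longrightarrow>
      (\<And>t. norm (E t) \<le> M) \<Longrightarrow> Ck_bounded (k - 1) C A \<Longrightarrow> Ck_bounded k (D * M) E"
      by blast
    define D' where "D' = 1 + 2 ^ k * (\<bar>C\<bar> * D)"
    have D': "1 \<le> D'" using D(1) by (simp add: D'_def)
    show ?case
    proof (intro exI[of _ D'] conjI allI impI)
      show "0 \<le> D'" using D' by simp
      fix E A :: "real \<Rightarrow> 'a" and M
      assume E: "\<forall>t. (E has_vector_derivative A t * E t) (at t)" "\<forall>t. norm (E t) \<le> M"
        and A: "Ck_bounded (Suc k - 1) C A"
      have C: "0 \<le> C" using A Ck_bounded_nonneg by blast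
      have M: "0 \<le> M" using E(2) norm_ge_zero order_trans by blast
      have "Ck_bounded k (D * M) E"
        using E A Ck_bounded_pred by (intro D(2)) auto
      then have "Ck_bounded k (2 ^ k * (C * (D * M))) (\<lambda>t. A t * E t)"
        using A by (intro Ck_bounded_mult) auto
      moreover have "2 ^ k * (C * (D * M)) \<le> D' * M" "M \<le> D' * M"
        using C M D' mult_right_mono[of 1 D' M] by (auto simp: D'_def algebra_simps)
      ultimately show "Ck_bounded (Suc k) (D' * M) E"
        using E by (intro Ck_boundedSucI[of _ _ "\<lambda>t. A t * E t"])
          (auto intro: Ck_bounded_weaken order_trans)
    qed
  qed
  then show ?thesis using that by blast
qed

lemma Ck_bounded_exp:
  obtains D where "\<And>f :: real \<Rightarrow> real. Ck_bounded k C f \<Longrightarrow> Ck_bounded k D (\<lambda>t. exp (f t))"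
proof -
  obtain D where D: "\<And>(E :: real \<Rightarrow> real) A M. (\<And>t. (E has_vector_derivative A t * E t) (at t)) \<Longrightarrow>
      (\<And>t. norm (E t) \<le> M) \<Longrightarrow> Ck_bounded (k - 1) C A \<Longrightarrow> Ck_bounded k (D * M) E"
    using Ck_bounded_linear_ode by metis
  have "Ck_bounded k (if k = 0 then exp C else D * exp C) (\<lambda>t. exp (f t))"
    if f: "Ck_bounded k C f" for f :: "real \<Rightarrow> real"
  proof -
    have b: "norm (exp (f t)) \<le> exp C" for t
      using Ck_boundedD[OF f, of t] by auto
    show ?thesis
    proof (cases k)
      case 0
      then show ?thesis using b f by (auto intro: continuous_on_exp)
    next
      case (Suc j)
      obtain f' where f': "\<And>t. (f has_vector_derivative f' t) (at t)" "Ck_bounded j C f'"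
        using f unfolding Suc by (rule Ck_boundedSucE) blast
      have "((\<lambda>t. exp (f t)) has_vector_derivative f' t * exp (f t)) (at t)" for t
        using f'(1)[of t] unfolding has_real_derivative_iff_has_vector_derivative[symmetric]
        by (auto intro!: derivative_eq_intros)
      then show ?thesis using D[of "\<lambda>t. exp (f t)" f', OF _ b] f'(2) Suc by simp
    qed
  qed
  then show ?thesis using that by blast
qed

lemma has_vector_derivative_series:
  fixes f :: "nat \<Rightarrow> real \<Rightarrow> 'a::banach"
  assumes f: "\<And>n t. (f n has_vector_derivative f' n t) (at t)"
    and f': "\<And>n t. norm (f' n t) \<le> c n" and c: "summable c" and "\<And>t. summable (\<lambda>n. f n t)"
  shows "((\<lambda>t. \<Sum>n. f n t) has_vector_derivative (\<Sum>n. f' n t)) (at t)"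
proof -
  have ul: "uniform_limit UNIV (\<lambda>n t. \<Sum>i<n. f' i t) (\<lambda>t. \<Sum>i. f' i t) sequentially"
    using f' by (intro Weierstrass_m_test[OF _ c]) auto
  have "\<exists>g. \<forall>t\<in>UNIV. (\<lambda>n. f n t) sums g t \<and> (g has_derivative (\<lambda>h. h *\<^sub>R (\<Sum>i. f' i t))) (at t within UNIV)"
  proof (rule has_derivative_series[where f' = "\<lambda>n t h. h *\<^sub>R f' n t" and x = 0])
    fix e :: real assume "e > 0"
    then have "\<forall>\<^sub>F n in sequentially. \<forall>t\<in>UNIV. dist (\<Sum>i<n. f' i t) (\<Sum>i. f' i t) < e"
      using ul by (auto simp: uniform_limit_iff)
    then show "\<forall>\<^sub>F n in sequentially. \<forall>x\<in>UNIV. \<forall>h.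
        norm ((\<Sum>i<n. h *\<^sub>R f' i x) - h *\<^sub>R (\<Sum>i. f' i x)) \<le> e * norm h"
    proof (eventually_elim, intro ballI allI)
      fix n x h assume *: "\<forall>t\<in>UNIV. dist (\<Sum>i<n. f' i t) (\<Sum>i. f' i t) < e"
      have "norm ((\<Sum>i<n. h *\<^sub>R f' i x) - h *\<^sub>R (\<Sum>i. f' i x))
          = dist (\<Sum>i<n. f' i x) (\<Sum>i. f' i x) * norm h"
        by (simp flip: scaleR_right.sum scaleR_diff_right add: dist_norm)
      also have "\<dots> \<le> e * norm h"
        using * by (intro mult_right_mono) (auto intro: less_imp_le)
      finally show "norm ((\<Sum>i<n. h *\<^sub>R f' i x) - h *\<^sub>R (\<Sum>i. f' i x)) \<le> e * norm h" .
    qed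
  qed (use f assms(4) in \<open>auto simp: has_vector_derivative_def summable_sums_iff\<close>)
  then obtain g where g: "\<And>t. (\<lambda>n. f n t) sums g t" "\<And>t. (g has_vector_derivative (\<Sum>i. f' i t)) (at t)"
    by (auto simp: has_vector_derivative_def)
  moreover have "g = (\<lambda>t. \<Sum>n. f n t)"
    using g(1) by (auto simp: sums_iff)
  ultimately show ?thesis by simp
qed

lemma Ck_bounded_suminf:
  fixes f :: "nat \<Rightarrow> real \<Rightarrow> 'a::banach"
  assumes "\<And>n. Ck_bounded k (c n) (f n)" and c: "summable c"
  shows "Ck_bounded k (\<Sum>n. c n) (\<lambda>t. \<Sum>n. f n t)"
  using assms(1)
proof (induction k arbitrary: f)
  case 0
  have b: "norm (f n t) \<le> c n" for n t using 0 by auto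
  have "uniform_limit UNIV (\<lambda>n t. \<Sum>i<n. f i t) (\<lambda>t. \<Sum>i. f i t) sequentially"
    using b by (intro Weierstrass_m_test[OF _ c]) auto
  then have "continuous_on UNIV (\<lambda>t. \<Sum>i. f i t)"
    by (rule uniform_limit_theorem[rotated]) (use 0 in \<open>auto intro!: continuous_on_sum always_eventually\<close>)
  then show ?case using b by (auto intro!: norm_suminf_le c)
next
  case (Suc k)
  have b: "norm (f n t) \<le> c n" for n t using Ck_boundedD[OF Suc.prems] .
  have "\<forall>n. \<exists>f'. (\<forall>t. (f n has_vector_derivative f' t) (at t)) \<and> Ck_bounded k (c n) f'"
    using Suc.prems by simp
  then obtain f' where f': "\<And>n t. (f n has_vector_derivative f' n t) (at t)"
      "\<And>n. Ck_bounded k (c n) (f' n)"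
    by metis
  show ?case
  proof (rule Ck_boundedSucI)
    show "norm (\<Sum>n. f n t) \<le> (\<Sum>n. c n)" for t
      using b by (intro norm_suminf_le c)
    show "((\<lambda>t. \<Sum>n. f n t) has_vector_derivative (\<Sum>n. f' n t)) (at t)" for t
      using f'(1) Ck_boundedD[OF f'(2)] summable_comparison_test'[OF c b]
      by (intro has_vector_derivative_series[OF _ _ c]) auto
    show "Ck_bounded k (\<Sum>n. c n) (\<lambda>t. \<Sum>n. f' n t)"
      using f' by (intro Suc.IH)
  qed
qed

section \<open>A single factor in the angular coordinate\<close>

text \<open>The factor with index \<open>n\<close> is expressed through functions of \<open>nt\<close>. Keeping \<open>n\<close> out of
\<open>circle_log\<close>, \<open>circle_frac\<close> and \<open>log_density\<close> makes their \<open>C^k\<close> bounds uniform; the powers of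
\<open>n\<close> come back through \<open>Ck_bounded_dilate\<close>.\<close>

definition circle_log :: "complex \<Rightarrow> real \<Rightarrow> complex" where
  "circle_log w t = Ln (1 + w * cis t)"

definition circle_frac :: "complex \<Rightarrow> real \<Rightarrow> complex" where
  "circle_frac w t = w * cis t / (1 + w * cis t)"

text \<open>The logarithm of the Poisson kernel \<open>(1 - |w|^2) / |1 + w cis t|^2\<close>.\<close>

definition log_density :: "complex \<Rightarrow> real \<Rightarrow> real" where
  "log_density w t = ln (1 - (norm w)\<^sup>2) - 2 * Re (circle_log w t)"

text \<open>The lift of \<open>phi n w\<close> to the real line; see \<open>phi_cis\<close>.\<close>

definition circle_step :: "nat \<Rightarrow> complex \<Rightarrow> real \<Rightarrow> real" where
  "circle_step n w t = t - 2 / real n * Im (circle_log w (real n * t))"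

lemma one_plus_Re_pos: "norm u < 1 \<Longrightarrow> 0 < Re (1 + u)"
  using complex_Re_le_cmod[of "-u"] by auto

lemma one_plus_notin_nonpos_Reals: "norm u < 1 \<Longrightarrow> 1 + (u :: complex) \<notin> \<real>\<^sub>\<le>\<^sub>0"
  using one_plus_Re_pos[of u] by (auto simp: complex_nonpos_Reals_iff simp del: plus_complex.simps)

lemma one_plus_nonzero: "norm u < 1 \<Longrightarrow> 1 + u \<noteq> (0::complex)"
  using one_plus_Re_pos[of u] by (metis less_irrefl zero_complex.sel(1))

lemma norm_one_plus_ge: "norm u \<le> r \<Longrightarrow> 1 - r \<le> norm (1 + u :: complex)"
  using norm_triangle_ineq2[of 1 "-u"] by simp

lemma has_vector_derivative_mult_cis:
  "((\<lambda>t. w * cis t) has_vector_derivative \<i> * (w * cis t)) (at t)"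
proof -
  have "(cis has_vector_derivative \<i> * cis t) (at t)"
    by (auto intro!: derivative_eq_intros simp: has_vector_derivative_complex_iff cis.ctr
      simp flip: has_real_derivative_iff_has_vector_derivative)
  then show ?thesis
    using has_vector_derivative_mult_right[of cis "\<i> * cis t" "at t" w] by (simp add: algebra_simps)
qed

lemma circle_log_has_derivative:
  assumes "norm w < 1"
  shows "(circle_log w has_vector_derivative \<i> * circle_frac w t) (at t)"
proof -
  have "((\<lambda>t. 1 + w * cis t) has_vector_derivative \<i> * (w * cis t)) (at t)"
    using has_vector_derivative_add[OF has_vector_derivative_const has_vector_derivative_mult_cis, of 1] by simp
  moreover have "(Ln has_field_derivative inverse (1 + w * cis t)) (at (1 + w * cis t))"
    using assms by (intro has_field_derivative_Ln one_plus_notin_nonpos_Reals) (simp add: norm_mult)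
  ultimately have "((Ln \<circ> (\<lambda>t. 1 + w * cis t)) has_vector_derivative \<i> * (w * cis t) * inverse (1 + w * cis t)) (at t)"
    by (rule field_vector_diff_chain_at)
  then show ?thesis by (simp add: circle_log_def[abs_def] circle_frac_def o_def divide_inverse mult.assoc)
qed

text \<open>With \<open>u = w cis t\<close> and \<open>V = u / (1 + u)\<close> one has \<open>u' = \<i> u\<close>, hence
\<open>V' = \<i> u / (1 + u)^2 = \<i> (1 - V) V\<close>. The right-hand side is written with \<open>V\<close> as last factor
so that the equation has the shape of \<open>Ck_bounded_linear_ode\<close>.\<close>

lemma circle_frac_has_derivative:
  assumes "norm w < 1"
  shows "(circle_frac w has_vector_derivative \<i> * (1 - circle_frac w t) * circle_frac w t) (at t)"
proof -
  define u where "u = w * cis t"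
  have u: "1 + u \<noteq> 0" using assms by (intro one_plus_nonzero) (simp add: norm_mult u_def)
  have "((\<lambda>u. u / (1 + u)) has_field_derivative 1 / (1 + u)\<^sup>2) (at u)"
    using u by (auto intro!: derivative_eq_intros simp: power2_eq_square)
  from field_vector_diff_chain_at[OF has_vector_derivative_mult_cis this[unfolded u_def]]
  have "(circle_frac w has_vector_derivative \<i> * u * (1 / (1 + u)\<^sup>2)) (at t)"
    by (simp add: circle_frac_def[abs_def] o_def u_def)
  also have "\<i> * u * (1 / (1 + u)\<^sup>2) = \<i> * (1 - u / (1 + u)) * (u / (1 + u))"
    using u by (simp add: divide_simps power2_eq_square)
  finally show ?thesis by (simp add: circle_frac_def[abs_def] u_def)
qed

lemma norm_circle_frac_le:
  assumes "norm w \<le> r" "r < 1"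
  shows "norm (circle_frac w t) \<le> norm w / (1 - r)"
  using norm_one_plus_ge[of "w * cis t" r] assms
  by (auto simp: circle_frac_def norm_divide norm_mult intro!: divide_left_mono mult_pos_pos)

lemma norm_circle_log_le:
  assumes "norm w \<le> r" "r < 1"
  shows "norm (circle_log w t) \<le> norm w / (1 - r)"
proof -
  have "norm (Ln (1 + w * cis t) - Ln (1 + 0)) \<le> 1 / (1 - r) * norm (w * cis t - 0)"
  proof (rule field_differentiable_bound[where S = "cball 0 r" and f' = "\<lambda>u. inverse (1 + u)"])
    fix u :: complex assume "u \<in> cball 0 r"
    then have u: "norm u \<le> r" by simp
    show "((\<lambda>u. Ln (1 + u)) has_field_derivative inverse (1 + u)) (at u within cball 0 r)"
      using one_plus_notin_nonpos_Reals[of u] u assms by (auto intro!: derivative_eq_intros simp: divide_inverse)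
    show "norm (inverse (1 + u)) \<le> 1 / (1 - r)"
      using norm_one_plus_ge[OF u] assms
      by (auto simp: norm_inverse divide_inverse intro!: le_imp_inverse_le)
  qed (use assms order_trans[OF norm_ge_zero assms(1)] in \<open>auto simp: norm_mult\<close>)
  then show ?thesis by (simp add: circle_log_def norm_mult)
qed

lemma abs_log_density_le:
  assumes "norm w \<le> r" "r < 1"
  shows "\<bar>log_density w t\<bar> \<le> 3 / (1 - r) * norm w"
proof -
  define x where "x = (norm w)\<^sup>2"
  have n: "0 \<le> norm w" "norm w < 1" using assms by auto
  have x: "0 \<le> x" "x < 1" using n by (auto simp: x_def power_less_one_iff)
  have "- ln (1 - x) = ln (1 / (1 - x))" using x by (simp add: ln_div)
  also have "\<dots> \<le> 1 / (1 - x) - 1" using x by (intro ln_le_minus_one) auto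
  also have "\<dots> = norm w / (1 - norm w) * (norm w / (1 + norm w))"
    using n x by (simp add: x_def field_simps power2_eq_square)
  also have "\<dots> \<le> norm w / (1 - norm w) * 1"
    using n add_pos_nonneg[of 1 "norm w"] by (intro mult_left_mono) (auto simp: divide_le_eq)
  also have "\<dots> \<le> norm w / (1 - r)" using assms n by (auto intro!: divide_left_mono)
  finally have "\<bar>ln (1 - x)\<bar> \<le> norm w / (1 - r)" using x ln_le_zero_iff[of "1 - x"] by auto
  moreover have "\<bar>Re (circle_log w t)\<bar> \<le> norm w / (1 - r)"
    using norm_circle_log_le[OF assms, of t] abs_Re_le_cmod[of "circle_log w t"] by linarith
  moreover have "\<bar>log_density w t\<bar> \<le> \<bar>ln (1 - x)\<bar> + 2 * \<bar>Re (circle_log w t)\<bar>"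
    by (simp add: log_density_def x_def)
  ultimately have "\<bar>log_density w t\<bar> \<le> 3 * (norm w / (1 - r))" by linarith
  then show ?thesis by simp
qed

text \<open>Both sides are the Poisson kernel: \<open>1 - 2 Re (u / (1 + u)) = Re ((1 - u) / (1 + u))\<close>.\<close>

lemma exp_log_density:
  assumes "norm w < 1"
  shows "exp (log_density w t) = 1 - 2 * Re (circle_frac w t)"
proof -
  define u where "u = w * cis t"
  have u: "norm u < 1" "norm u = norm w" using assms by (auto simp: u_def norm_mult)
  have nz: "1 + u \<noteq> 0" using u one_plus_nonzero by auto
  have sq: "(norm w)\<^sup>2 < 1" using assms by (simp add: power_less_one_iff)
  have "exp (Re (Ln (1 + u))) = norm (1 + u)" using nz by simp
  then have "exp (2 * Re (Ln (1 + u))) = (norm (1 + u))\<^sup>2"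
    by (simp add: exp_double)
  then have "exp (log_density w t) = (1 - (norm u)\<^sup>2) / (norm (1 + u))\<^sup>2"
    using sq u by (simp add: log_density_def circle_log_def exp_diff u_def)
  also have "\<dots> = 1 - 2 * Re (u / (1 + u))"
  proof -
    have "Re (u / (1 + u)) = Re (u * cnj (1 + u)) / (norm (1 + u))\<^sup>2"
      by (subst complex_div_cnj) (simp add: Re_divide_of_real flip: of_real_power)
    moreover have "1 - (norm u)\<^sup>2 = (norm (1 + u))\<^sup>2 - 2 * Re (u * cnj (1 + u))"
      by (simp add: cmod_power2) (simp add: power2_eq_square algebra_simps)
    ultimately show ?thesis using nz by (simp add: diff_divide_distrib)
  qed
  finally show ?thesis by (simp add: circle_frac_def u_def)
qed

lemma log_density_has_derivative:
  assumes "norm w < 1"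
  shows "(log_density w has_vector_derivative 2 * Im (circle_frac w t)) (at t)"
proof -
  have "((\<lambda>t. ln (1 - (norm w)\<^sup>2) - 2 * Re (circle_log w t)) has_vector_derivative
      0 - 2 * Re (\<i> * circle_frac w t)) (at t)"
    using assms
    by (intro has_vector_derivative_diff has_vector_derivative_const has_vector_derivative_mult_right
        bounded_linear.has_vector_derivative[OF bounded_linear_Re] circle_log_has_derivative)
  then show ?thesis by (simp add: log_density_def[abs_def])
qed

lemma circle_step_has_derivative:
  assumes "norm w < 1" "1 \<le> n"
  shows "(circle_step n w has_vector_derivative exp (log_density w (real n * t))) (at t)"
proof -
  have "((\<lambda>t. real n * t) has_vector_derivative real n) (at t)"
    by (auto intro!: derivative_eq_intros simp flip: has_real_derivative_iff_has_vector_derivative)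
  then have "((\<lambda>t. t - 2 / real n * Im (circle_log w (real n * t))) has_vector_derivative
      1 - 2 / real n * Im (real n *\<^sub>R (\<i> * circle_frac w (real n * t)))) (at t)"
    using assms
    by (intro has_vector_derivative_diff has_vector_derivative_id has_vector_derivative_mult_right
        bounded_linear.has_vector_derivative[OF bounded_linear_Im] circle_log_has_derivative
        has_vector_derivative_compose_real)
  then show ?thesis using assms by (simp add: circle_step_def[abs_def] exp_log_density)
qed

lemma circle_step_displacement:
  assumes "norm w \<le> r" "r < 1" "1 \<le> n"
  shows "\<bar>circle_step n w t - t\<bar> \<le> 2 / (1 - r) * norm w"
proof -
  have "\<bar>circle_step n w t - t\<bar> = 2 / real n * \<bar>Im (circle_log w (real n * t))\<bar>"
    by (simp add: circle_step_def abs_mult)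
  also have "\<dots> \<le> 2 * (norm w / (1 - r))"
    using assms norm_circle_log_le[OF assms(1,2), of "real n * t"]
      abs_Im_le_cmod[of "circle_log w (real n * t)"]
    by (intro mult_mono) (auto simp: divide_le_eq)
  finally show ?thesis by simp
qed

lemma circle_step_periodic: "circle_step n w (t + 2 * pi) = circle_step n w t + 2 * pi"
proof -
  have "cis (real n * (t + 2 * pi)) = cis (real n * t) * cis (2 * pi * real n)"
    by (simp add: algebra_simps cis_mult)
  then have "cis (real n * (t + 2 * pi)) = cis (real n * t)" by (simp add: cis_multiple_2pi)
  then show ?thesis by (simp add: circle_step_def circle_log_def)
qed

text \<open>On the unit circle \<open>z^(-n)\<close> is the conjugate of \<open>z^n\<close>, so numerator and denominator are complex
conjugates and only twice the argument survives. Since \<open>1 + w z^n\<close> lies in the right half-plane, the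
principal logarithm commutes with conjugation.\<close>

lemma phi_factor_cis:
  assumes "norm w < 1" "1 \<le> n"
  shows "phi_factor n w (cis t) = cis (circle_step n w t - t)"
proof -
  define u where "u = w * cis (real n * t)"
  define L where "L = Ln (1 + u)"
  have u: "norm u < 1" using assms by (simp add: u_def norm_mult)
  have "w * cis t ^ n = u" by (simp add: u_def Complex.DeMoivre)
  moreover have "cis t powi (- int n) = cnj (cis (real n * t))"
    by (simp add: power_int_minus Complex.DeMoivre cis_cnj)
  then have "1 + cnj w * cis t powi (- int n) = cnj (1 + u)" by (simp add: u_def)
  moreover have "Ln (cnj (1 + u)) = cnj L"
    unfolding L_def using u by (intro cnj_Ln[symmetric] one_plus_notin_nonpos_Reals)
  ultimately have "phi_factor n w (cis t) = exp (1 / of_nat n * cnj L) / exp (1 / of_nat n * L)"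
    using one_plus_nonzero[OF u] complex_cnj_zero_iff[of "1 + u"]
    unfolding phi_factor_def powr_def L_def by (simp del: complex_cnj_zero_iff complex_cnj_add)
  also have "\<dots> = exp (\<i> * of_real (- 2 / real n * Im L))"
    unfolding exp_diff[symmetric] by (rule arg_cong[of _ _ exp])
      (auto simp: complex_eq_iff algebra_simps Re_divide_of_nat Im_divide_of_nat)
  also have "\<dots> = cis (circle_step n w t - t)"
    by (simp add: cis_conv_exp circle_step_def circle_log_def L_def u_def)
  finally show ?thesis .
qed

lemma phi_cis:
  assumes "norm w < 1" "1 \<le> n"
  shows "phi n w (cis t) = cis (circle_step n w t)"
  by (simp add: phi_def phi_factor_cis[OF assms] cis_mult)

text \<open>The equation for \<open>V = circle_frac w\<close> is quadratic, but it may be read as the linear equation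
\<open>V' = A V\<close> with \<open>A = \<i> (1 - V)\<close>. A bound on \<open>V\<close> of order \<open>k\<close> bounds \<open>A\<close>, and
the linear estimate returns a bound of order \<open>k + 1\<close> that is still proportional to \<open>|w|\<close>.\<close>

lemma Ck_bounded_circle_frac:
  assumes "r < 1"
  obtains D where "0 \<le> D" "\<And>w. norm w \<le> r \<Longrightarrow> Ck_bounded k (D * norm w) (circle_frac w)"
proof -
  have ode: "(circle_frac w has_vector_derivative (\<i> * (1 - circle_frac w t)) * circle_frac w t) (at t)"
    "norm (circle_frac w t) \<le> norm w / (1 - r)" if "norm w \<le> r" for w t
    using that assms circle_frac_has_derivative norm_circle_frac_le by auto
  have "\<exists>D\<ge>0. \<forall>w. norm w \<le> r \<longrightarrow> Ck_bounded k (D * norm w) (circle_frac w)"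
  proof (induction k)
    case 0
    show ?case
      using assms continuous_on_UNIV_if_vector_derivative[OF ode(1)] ode(2)
      by (intro exI[of _ "1 / (1 - r)"]) auto
  next
    case (Suc k)
    then obtain D where D: "0 \<le> D" "\<And>w. norm w \<le> r \<Longrightarrow> Ck_bounded k (D * norm w) (circle_frac w)"
      by blast
    obtain D' where D': "0 \<le> D'"
      "\<And>(E :: real \<Rightarrow> complex) A M. (\<And>t. (E has_vector_derivative A t * E t) (at t)) \<Longrightarrow>
      (\<And>t. norm (E t) \<le> M) \<Longrightarrow> Ck_bounded (Suc k - 1) (1 * (1 + 1 * D)) A \<Longrightarrow> Ck_bounded (Suc k) (D' * M) E"
      using Ck_bounded_linear_ode by blast
    have "Ck_bounded (Suc k) (D' * (norm w / (1 - r))) (circle_frac w)" if w: "norm w \<le> r" for w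
    proof (rule D'(2))
      have "Ck_bounded k D (circle_frac w)"
        by (rule Ck_bounded_weaken[OF D(2)[OF w]]) (use D(1) w assms in \<open>auto intro: mult_left_le\<close>)
      then have "Ck_bounded k (1 * D) (\<lambda>t. - circle_frac w t)"
        by (intro Ck_bounded_linear[OF bounded_linear_minus]) (auto intro: bounded_linear_ident)
      then have "Ck_bounded k (1 + 1 * D) (\<lambda>t. 1 + - circle_frac w t)"
        by (intro Ck_bounded_add Ck_bounded_const) auto
      then have "Ck_bounded k (1 * (1 + 1 * D)) (\<lambda>t. \<i> * (1 + - circle_frac w t))"
        by (intro Ck_bounded_linear[OF bounded_linear_mult_right]) (auto simp: norm_mult)
      then show "Ck_bounded (Suc k - 1) (1 * (1 + 1 * D)) (\<lambda>t. \<i> * (1 - circle_frac w t))" by simp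
    qed (use ode w in auto)
    then show ?case using D'(1) assms by (intro exI[of _ "D' / (1 - r)"]) auto
  qed
  then show ?thesis using that by blast
qed

lemma Ck_bounded_log_density:
  assumes "r < 1"
  obtains D where "0 \<le> D" "\<And>w. norm w \<le> r \<Longrightarrow> Ck_bounded k (D * norm w) (log_density w)"
proof -
  obtain D where D: "0 \<le> D" "\<And>w. norm w \<le> r \<Longrightarrow> Ck_bounded k (D * norm w) (circle_frac w)"
    using Ck_bounded_circle_frac[OF assms] by blast
  define D' where "D' = max (3 / (1 - r)) (2 * D)"
  have le: "3 / (1 - r) * x \<le> D' * x" "2 * (D * x) \<le> D' * x" if "0 \<le> x" for x
    using that mult_right_mono[of "3 / (1 - r)" D' x] mult_right_mono[of "2 * D" D' x]
    by (auto simp: D'_def)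
  have "Ck_bounded (Suc k) (D' * norm w) (log_density w)" if w: "norm w \<le> r" for w
  proof (rule Ck_boundedSucI)
    show "norm (log_density w t) \<le> D' * norm w" for t
      using abs_log_density_le[OF w assms, of t] le[of "norm w"] by simp
    show "(log_density w has_vector_derivative 2 * Im (circle_frac w t)) (at t)" for t
      using w assms by (intro log_density_has_derivative) auto
    have "Ck_bounded k (2 * (D * norm w)) (\<lambda>t. 2 * Im (circle_frac w t))"
      using D(2)[OF w] abs_Im_le_cmod
      by (intro Ck_bounded_linear[of "\<lambda>z. 2 * Im z"] bounded_linear_const_mult bounded_linear_Im)
        (auto simp: abs_mult)
    then show "Ck_bounded k (D' * norm w) (\<lambda>t. 2 * Im (circle_frac w t))"
      by (rule Ck_bounded_weaken) (use le in auto)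
  qed
  moreover have "0 \<le> D'" using D(1) by (simp add: D'_def)
  ultimately show ?thesis using that Ck_bounded_SucD by blast
qed

section \<open>Infinite compositions on the line\<close>

text \<open>Here \<open>m n\<close> and \<open>v n\<close> are the index and the parameter of the \<open>n\<close>-th map in a composition, in the
order in which the maps are applied; \<open>l\<close> is the number of derivatives controlled by the summability
condition. The uniform bound \<open>r\<close> keeps the Poisson kernels away from their singularities.\<close>

locale circle_composition =
  fixes m :: "nat \<Rightarrow> nat" and v :: "nat \<Rightarrow> complex" and r :: real and l :: nat
  assumes m_ge_1: "1 \<le> m n" and v_le: "norm (v n) \<le> r" and r_less_1: "r < 1"
    and summable_weighted: "summable (\<lambda>n. real (m n) ^ l * norm (v n))"
begin

primrec lift_part :: "nat \<Rightarrow> real \<Rightarrow> real" where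
  "lift_part 0 = (\<lambda>t. t)"
| "lift_part (Suc n) = (\<lambda>t. circle_step (m n) (v n) (lift_part n t))"

text \<open>By the chain rule \<open>log_deriv_term n\<close> is the logarithm of the \<open>n\<close>-th factor in the derivative of
every longer composition.\<close>

definition log_deriv_term :: "nat \<Rightarrow> real \<Rightarrow> real" where
  "log_deriv_term n t = log_density (v n) (real (m n) * lift_part n t)"

definition log_deriv :: "real \<Rightarrow> real" where
  "log_deriv t = (\<Sum>n. log_deriv_term n t)"

definition displacement :: "nat \<Rightarrow> real \<Rightarrow> real" where
  "displacement n t = lift_part (Suc n) t - lift_part n t"

definition lift_lim :: "real \<Rightarrow> real" where
  "lift_lim t = t + (\<Sum>n. displacement n t)"

lemma v_less_1: "norm (v n) < 1"
  using v_le[of n] r_less_1 by linarith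

lemma real_m_ge_1: "1 \<le> real (m n)"
  using m_ge_1[of n] by simp

lemma v_le_weighted: "norm (v n) \<le> real (m n) ^ l * norm (v n)"
  using mult_right_mono[OF one_le_power[OF real_m_ge_1[of n]], of "norm (v n)" l] by simp

lemma summable_v: "summable (\<lambda>n. norm (v n))"
  by (rule summable_comparison_test'[OF summable_weighted, of 0]) (use v_le_weighted in auto)

lemma lift_part_has_derivative:
  "(lift_part N has_vector_derivative exp (\<Sum>n<N. log_deriv_term n t)) (at t)"
proof (induction N)
  case 0
  then show ?case by simp
next
  case (Suc N)
  from has_vector_derivative_compose_real[OF Suc circle_step_has_derivative[OF v_less_1 m_ge_1]]
  show ?case by (simp add: log_deriv_term_def exp_add)
qed

text \<open>One half of the bootstrap: summable bounds on the terms of the logarithm bound the derivatives of all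
partial compositions at once.\<close>

lemma Ck_bounded_partial_derivatives:
  assumes "0 \<le> K" "\<And>n. Ck_bounded k (K * (real (m n) ^ l * norm (v n))) (log_deriv_term n)"
  obtains M where "\<And>N. Ck_bounded k M (\<lambda>t. exp (\<Sum>n<N. log_deriv_term n t))"
proof -
  define C where "C = (\<Sum>n. K * (real (m n) ^ l * norm (v n)))"
  have "Ck_bounded k C (\<lambda>t. \<Sum>n<N. log_deriv_term n t)" for N
  proof (rule Ck_bounded_weaken[OF Ck_bounded_sum[OF assms(2)]])
    show "(\<Sum>n<N. K * (real (m n) ^ l * norm (v n))) \<le> C"
      unfolding C_def using assms(1) summable_weighted by (intro sum_le_suminf summable_mult) auto
  qed
  moreover obtain M where "\<And>f :: real \<Rightarrow> real. Ck_bounded k C f \<Longrightarrow> Ck_bounded k M (\<lambda>t. exp (f t))"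
    using Ck_bounded_exp by blast
  ultimately show ?thesis using that by blast
qed

text \<open>The other half, and the main induction on the order \<open>k\<close>. A bound of order \<open>k + 1\<close> on the
term \<open>h\<^sub>n \<circ> F\<^bsub>n-1\<^esub>\<close> involves only \<open>k\<close> derivatives of \<open>F\<^bsub>n-1\<^esub>'\<close>, which the
previous step bounds uniformly in \<open>n\<close>.\<close>

lemma Ck_bounded_log_deriv_term:
  assumes "k \<le> l"
  obtains K where "0 \<le> K"
    "\<And>n. Ck_bounded k (K * (real (m n) ^ l * norm (v n))) (log_deriv_term n)"
proof -
  have "\<exists>K\<ge>0. \<forall>n. Ck_bounded k (K * (real (m n) ^ l * norm (v n))) (log_deriv_term n)"
    using assms
  proof (induction k)
    case 0
    obtain D where D: "0 \<le> D" "\<And>w. norm w \<le> r \<Longrightarrow> Ck_bounded 0 (D * norm w) (log_density w)"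
      using Ck_bounded_log_density[OF r_less_1] by blast
    have "continuous_on UNIV (log_deriv_term n)" for n
      unfolding log_deriv_term_def[abs_def]
    proof (rule continuous_on_compose2[OF Ck_bounded_continuous[OF D(2)[OF v_le]]])
      show "continuous_on UNIV (\<lambda>t. real (m n) * lift_part n t)"
        by (intro continuous_intros continuous_on_UNIV_if_vector_derivative[OF lift_part_has_derivative])
    qed auto
    moreover have "norm (log_deriv_term n t) \<le> D * (real (m n) ^ l * norm (v n))" for n t
      unfolding log_deriv_term_def
      by (rule order_trans[OF Ck_boundedD[OF D(2)[OF v_le]] mult_left_mono[OF v_le_weighted D(1)]])
    ultimately show ?case using D(1) by auto
  next
    case (Suc k)
    then obtain K where K: "0 \<le> K"
      "\<And>n. Ck_bounded k (K * (real (m n) ^ l * norm (v n))) (log_deriv_term n)"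
      by auto
    obtain M where M: "\<And>N. Ck_bounded k M (\<lambda>t. exp (\<Sum>n<N. log_deriv_term n t))"
      using Ck_bounded_partial_derivatives[OF K] by blast
    obtain D where D: "0 \<le> D" "\<And>w. norm w \<le> r \<Longrightarrow> Ck_bounded (Suc k) (D * norm w) (log_density w)"
      using Ck_bounded_log_density[OF r_less_1] by blast
    obtain K' where K': "0 \<le> K'"
      "\<And>(h :: real \<Rightarrow> real) (f :: real \<Rightarrow> real) f' C. Ck_bounded (Suc k) C h \<Longrightarrow>
        (\<And>t. (f has_vector_derivative f' t) (at t)) \<Longrightarrow> Ck_bounded (Suc k - 1) M f' \<Longrightarrow>
        Ck_bounded (Suc k) (K' * C) (\<lambda>t. h (f t))"
      using Ck_bounded_compose[where ?'a = real] by blast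
    have "Ck_bounded (Suc k) (K' * D * (real (m n) ^ l * norm (v n))) (log_deriv_term n)" for n
    proof -
      have "Ck_bounded (Suc k) (real (m n) ^ Suc k * (D * norm (v n))) (\<lambda>t. log_density (v n) (real (m n) * t))"
        by (intro Ck_bounded_dilate D v_le real_m_ge_1)
      then have "Ck_bounded (Suc k) (K' * (real (m n) ^ Suc k * (D * norm (v n)))) (log_deriv_term n)"
        unfolding log_deriv_term_def[abs_def]
        using M[of n] by (intro K'(2)[OF _ lift_part_has_derivative]) auto
      moreover have "K' * (real (m n) ^ Suc k * (D * norm (v n))) \<le> K' * (real (m n) ^ l * (D * norm (v n)))"
        using K'(1) D(1) Suc.prems real_m_ge_1[of n]
        by (intro mult_left_mono mult_right_mono power_increasing) auto
      ultimately show ?thesis by (simp add: Ck_bounded_weaken mult_ac del: Ck_bounded.simps power_Suc)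
    qed
    then show ?case using K'(1) D(1) by (intro exI[of _ "K' * D"]) auto
  qed
  then show ?thesis using that by blast
qed

lemma summable_log_deriv_term: "summable (\<lambda>n. log_deriv_term n t)"
proof -
  obtain K where "0 \<le> K"
    "\<And>n. Ck_bounded 0 (K * (real (m n) ^ l * norm (v n))) (log_deriv_term n)"
    using Ck_bounded_log_deriv_term[of 0] by auto
  then show ?thesis
    by (intro summable_comparison_test'[OF summable_mult[OF summable_weighted, of K]]) auto
qed

lemma Ck_bounded_log_deriv: obtains C where "Ck_bounded l C log_deriv"
proof -
  obtain K where "0 \<le> K"
    "\<And>n. Ck_bounded l (K * (real (m n) ^ l * norm (v n))) (log_deriv_term n)"
    using Ck_bounded_log_deriv_term[of l] by auto
  then have "Ck_bounded l (\<Sum>n. K * (real (m n) ^ l * norm (v n))) log_deriv"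
    unfolding log_deriv_def[abs_def]
    by (intro Ck_bounded_suminf summable_mult summable_weighted)
  then show ?thesis by (rule that)
qed

lemma summable_displacement: "summable (\<lambda>n. displacement n t)"
  by (rule summable_comparison_test'[OF summable_mult[OF summable_v, of "2 / (1 - r)"], of 0])
    (use circle_step_displacement[OF v_le r_less_1 m_ge_1] in \<open>simp add: displacement_def\<close>)

lemma lift_part_eq_sum: "lift_part N t = t + (\<Sum>n<N. displacement n t)"
  by (induction N) (simp_all add: displacement_def)

lemma lift_part_tendsto: "(\<lambda>N. lift_part N t) \<longlonglongrightarrow> lift_lim t"
  unfolding lift_part_eq_sum lift_lim_def
  by (intro tendsto_intros summable_LIMSEQ summable_displacement)

lemma lift_lim_periodic: "lift_lim (t + 2 * pi) = lift_lim t + 2 * pi"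
proof (rule LIMSEQ_unique)
  have "lift_part N (t + 2 * pi) = lift_part N t + 2 * pi" for N
    by (induction N) (auto simp: circle_step_periodic)
  then show "(\<lambda>N. lift_part N (t + 2 * pi)) \<longlonglongrightarrow> lift_lim t + 2 * pi"
    by (auto intro!: tendsto_intros lift_part_tendsto)
qed (rule lift_part_tendsto)

text \<open>The series of displacements is differentiated term by term. Its differentiated terms are
\<open>F\<^sub>n' (exp h - 1)\<close>, where \<open>F\<^sub>n'\<close> is bounded and \<open>exp h - 1\<close> is \<open>O(|v n|)\<close>, and their sum
telescopes.\<close>

lemma lift_lim_has_derivative: "(lift_lim has_vector_derivative exp (log_deriv t)) (at t)"
proof -
  define E where "E N t = exp (\<Sum>n<N. log_deriv_term n t)" for N t
  obtain K where K: "0 \<le> K"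
    "\<And>n. Ck_bounded 0 (K * (real (m n) ^ l * norm (v n))) (log_deriv_term n)"
    using Ck_bounded_log_deriv_term[of 0] by auto
  obtain M where M: "\<And>N. Ck_bounded 0 M (E N)"
    using Ck_bounded_partial_derivatives[OF K] unfolding E_def[abs_def] by blast
  have bound: "norm (E (Suc n) t - E n t) \<le> M * (2 * (norm (v n) / (1 - r)))" for n t
  proof -
    have "E (Suc n) t - E n t = E n t * (exp (log_deriv_term n t) - 1)"
      by (simp add: E_def exp_add algebra_simps)
    moreover have "\<bar>exp (log_deriv_term n t) - 1\<bar> \<le> 2 * (norm (v n) / (1 - r))"
      using norm_circle_frac_le[OF v_le r_less_1, of n "real (m n) * lift_part n t"]
        abs_Re_le_cmod[of "circle_frac (v n) (real (m n) * lift_part n t)"]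
      by (simp add: log_deriv_term_def exp_log_density[OF v_less_1])
    ultimately show ?thesis
      using mult_mono[OF Ck_boundedD[OF M, of n t] _ Ck_bounded_nonneg[OF M]]
      by (simp only: real_norm_def abs_mult abs_ge_zero)
  qed
  have "(displacement n has_vector_derivative E (Suc n) t - E n t) (at t)" for n t
    unfolding displacement_def[abs_def] E_def
    by (intro has_vector_derivative_diff lift_part_has_derivative)
  moreover have "summable (\<lambda>n. M * (2 * (norm (v n) / (1 - r))))"
    by (intro summable_mult summable_divide summable_v)
  ultimately have "((\<lambda>t. \<Sum>n. displacement n t) has_vector_derivative (\<Sum>n. E (Suc n) t - E n t)) (at t)"
    using bound summable_displacement by (intro has_vector_derivative_series)
  moreover have "(\<lambda>n. E (Suc n) t - E n t) sums (exp (log_deriv t) - E 0 t)"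
    unfolding E_def log_deriv_def
    by (intro telescope_sums tendsto_exp summable_LIMSEQ summable_log_deriv_term)
  then have "(\<Sum>n. E (Suc n) t - E n t) = exp (log_deriv t) - 1"
    by (simp add: sums_iff E_def)
  ultimately have "((\<lambda>t. t + (\<Sum>n. displacement n t)) has_vector_derivative 1 + (exp (log_deriv t) - 1)) (at t)"
    by (intro has_vector_derivative_add has_vector_derivative_id) simp
  then show ?thesis by (simp add: lift_lim_def[abs_def])
qed

end

section \<open>Circle maps and their lifts\<close>

lemma cis_Arg_sphere: "z \<in> sphere 0 1 \<Longrightarrow> cis (Arg z) = z"
  using cis_Arg[of z] by (cases "z = 0") (simp_all add: sgn_div_norm)

text \<open>The map \<open>cis\<close> is a closed map from a compact interval onto the circle, so continuity may be tested
upstairs: preimages of closed sets are images of compact sets.\<close>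

lemma continuous_on_sphere_if_lift:
  assumes F: "continuous_on UNIV F" and f: "\<And>t. f (cis t) = cis (F t)"
  shows "continuous_on (sphere 0 1) f"
  unfolding continuous_on_closed_vimage[OF closed_sphere]
proof (intro allI impI)
  fix B :: "complex set" assume B: "closed B"
  have cont: "continuous_on {-pi..pi} (\<lambda>t. cis (F t))"
    using continuous_on_subset[OF F subset_UNIV] by (rule continuous_on_cis)
  have "closed ((\<lambda>t. cis (F t)) -` B \<inter> {-pi..pi})"
    using cont B unfolding continuous_on_closed_vimage[OF closed_atLeastAtMost] by simp
  then have "compact ((\<lambda>t. cis (F t)) -` B \<inter> {-pi..pi})"
    unfolding compact_eq_bounded_closed
    using bounded_subset[OF compact_imp_bounded[OF compact_Icc[of "-pi" pi]] Int_lower2] by blast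
  then have "compact (cis ` ((\<lambda>t. cis (F t)) -` B \<inter> {-pi..pi}))"
    by (intro compact_continuous_image continuous_on_cis continuous_on_id)
  moreover have "f -` B \<inter> sphere 0 1 = cis ` ((\<lambda>t. cis (F t)) -` B \<inter> {-pi..pi})"
  proof (intro equalityI subsetI)
    fix z assume z: "z \<in> f -` B \<inter> sphere 0 1"
    then have "z = cis (Arg z)" using cis_Arg_sphere by auto
    then show "z \<in> cis ` ((\<lambda>t. cis (F t)) -` B \<inter> {-pi..pi})"
      using z f[of "Arg z"] mpi_less_Arg[of z] Arg_le_pi[of z] by (intro image_eqI[of _ _ "Arg z"]) auto
  qed (use f in auto)
  ultimately show "closed (f -` B \<inter> sphere 0 1)" by (simp add: compact_imp_closed)
qed

lemma periodic_int_multiple: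
  fixes F :: "real \<Rightarrow> real"
  assumes "\<And>t. F (t + c) = F t + c"
  shows "F (t + of_int k * c) = F t + of_int k * c"
proof -
  have nat: "F (t + of_nat n * c) = F t + of_nat n * c" for n t
  proof (induction n)
    case (Suc n)
    have "F (t + of_nat (Suc n) * c) = F ((t + of_nat n * c) + c)"
      by (rule arg_cong[of _ _ F]) (simp add: algebra_simps)
    then show ?case unfolding assms Suc by (simp add: algebra_simps)
  qed simp
  show ?thesis
  proof (cases k)
    case (nonneg n)
    then show ?thesis using nat[of t n] by simp
  next
    case (neg n)
    have "of_int k * c + of_nat (Suc n) * c = (of_int k + of_nat (Suc n)) * c"
      by (simp only: distrib_right)
    also have "of_int k + of_nat (Suc n) = (0 :: real)" unfolding neg by simp
    finally have 0: "of_int k * c + of_nat (Suc n) * c = 0" by simp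
    then have "F (t + of_int k * c + of_nat (Suc n) * c) = F t" by (simp only: add.assoc add_0_right)
    then show ?thesis using 0 unfolding nat by linarith
  qed
qed

text \<open>A lift that commutes with the translation by \<open>2\<pi>\<close> induces a well-defined map of the circle.\<close>

lemma cis_eq_imp_lift_cis_eq:
  assumes F: "\<And>t. F (t + 2 * pi) = F t + 2 * pi" and "cis s = cis t"
  shows "cis (F s) = cis (F t)"
proof -
  from assms(2) have "\<exists>k::int. \<i> * of_real s = \<i> * of_real t + (of_int (2 * k) * pi) * \<i>"
    unfolding cis_conv_exp exp_eq .
  then obtain k :: int where "\<i> * of_real s = \<i> * of_real t + of_int (2 * k) * of_real pi * \<i>" by auto
  then have "Im (\<i> * of_real s) = Im (\<i> * of_real t + of_int (2 * k) * of_real pi * \<i>)" by (rule arg_cong)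
  then have "s = t + of_int k * (2 * pi)" by simp
  then have "F s = F t + of_int k * (2 * pi)"
    using periodic_int_multiple[where F = F and c = "2 * pi", OF F] by simp
  then have "cis (F s) = cis (F t) * cis (2 * pi * of_int k)" by (simp add: cis_mult mult.commute)
  then show ?thesis by (simp add: cis_multiple_2pi)
qed

text \<open>The derivative is positive, so \<open>F\<close> is injective; by periodicity it is unbounded in both directions, so
it is onto by the intermediate value theorem.\<close>

lemma lift_inverse:
  fixes F L :: "real \<Rightarrow> real"
  assumes F: "\<And>t. (F has_vector_derivative exp (L t)) (at t)"
    and per: "\<And>t. F (t + 2 * pi) = F t + 2 * pi"
  obtains G where "strict_mono F" "\<And>t. F (G t) = t" "\<And>t. G (F t) = t"
    "\<And>t. (G has_vector_derivative exp (- L (G t))) (at t)" "\<And>t. G (t + 2 * pi) = G t + 2 * pi"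
proof -
  have D: "(F has_real_derivative exp (L t)) (at t)" for t
    using F by (simp add: has_real_derivative_iff_has_vector_derivative)
  have mono: "strict_mono F"
    by (rule strict_monoI, rule DERIV_pos_imp_increasing) (use D in \<open>auto intro: exp_gt_zero\<close>)
  have contF: "continuous_on A F" for A
    using continuous_on_UNIV_if_vector_derivative[OF F] continuous_on_subset by blast
  have "\<exists>t. F t = y" for y
  proof -
    \<comment> \<open>Enough full turns to pass \<open>y\<close> in both directions.\<close>
    define k where "k = \<lceil>\<bar>y - F 0\<bar> / (2 * pi)\<rceil>"
    have k: "\<bar>y - F 0\<bar> / (2 * pi) \<le> of_int k" by (simp add: k_def)
    then have "0 \<le> real_of_int k" by (rule order_trans[rotated]) simp
    have y: "\<bar>y - F 0\<bar> \<le> of_int k * (2 * pi)" using k by (simp add: divide_le_eq)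
    have F_per: "F (of_int i * (2 * pi)) = F 0 + of_int i * (2 * pi)" for i
      using periodic_int_multiple[where F = F and c = "2 * pi" and t = 0 and k = i, OF per] by simp
    have "\<exists>t\<ge>of_int (- k) * (2 * pi). t \<le> of_int k * (2 * pi) \<and> F t = y"
    proof (rule IVT')
      show "F (of_int (- k) * (2 * pi)) \<le> y" "y \<le> F (of_int k * (2 * pi))"
        unfolding F_per using y by (auto simp: abs_le_iff)
      show "of_int (- k) * (2 * pi) \<le> of_int k * (2 * pi)"
        using \<open>0 \<le> real_of_int k\<close> by (intro mult_right_mono) auto
    qed (rule contF)
    then show ?thesis by blast
  qed
  then obtain G where FG: "\<And>y. F (G y) = y" by metis
  have GF: "G (F t) = t" for t
    using FG strict_mono_eq[OF mono] by blast
  have contG: "isCont G y" for y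
    using isCont_inverse_function[of 1 "G y" G F, OF _ GF DERIV_isCont[OF D]] by (simp add: FG)
  have "(G has_real_derivative inverse (exp (L (G y)))) (at y)" for y
    by (rule DERIV_inverse_function[OF D _ _ _ FG contG, of _ "y - 1" "y + 1"]) auto
  then have "(G has_vector_derivative exp (- L (G y))) (at y)" for y
    by (simp add: exp_minus flip: has_real_derivative_iff_has_vector_derivative)
  moreover have "G (t + 2 * pi) = G t + 2 * pi" for t
    using GF[of "G t + 2 * pi"] unfolding per FG .
  ultimately show ?thesis using that mono FG GF by blast
qed

text \<open>Bootstrap on \<open>G' = exp (- L(G))\<close>: if \<open>G'\<close> is bounded in \<open>C^k\<close> then, by the composition estimate, so is
\<open>L \<circ> G\<close> in \<open>C^(k+1)\<close> while \<open>k + 1 \<le> l\<close>, and with it the right-hand side.\<close>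

lemma Ck_bounded_inverse_derivative:
  fixes G L :: "real \<Rightarrow> real"
  assumes G: "\<And>t. (G has_vector_derivative exp (- L (G t))) (at t)" and L: "Ck_bounded l C L"
  obtains M where "Ck_bounded l M (\<lambda>t. exp (- L (G t)))"
proof -
  have nL: "Ck_bounded l (1 * C) (\<lambda>t. - L t)"
    using L by (intro Ck_bounded_linear[OF bounded_linear_minus[OF bounded_linear_ident]]) auto
  have "k \<le> l \<Longrightarrow> \<exists>M. Ck_bounded k M (\<lambda>t. exp (- L (G t)))" for k
  proof (induction k)
    case 0
    have "continuous_on UNIV (\<lambda>t. exp (- L (G t)))"
      by (intro continuous_on_exp continuous_on_minus continuous_on_compose2[OF Ck_bounded_continuous[OF L]]
          continuous_on_UNIV_if_vector_derivative[OF G] subset_UNIV)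
    moreover have "norm (exp (- L (G t))) \<le> exp C" for t
      using Ck_boundedD[OF L, of "G t"] by auto
    ultimately show ?case by auto
  next
    case (Suc k)
    then obtain M where M: "Ck_bounded k M (\<lambda>t. exp (- L (G t)))" by auto
    obtain K where K: "0 \<le> K" "\<And>(h :: real \<Rightarrow> real) (f :: real \<Rightarrow> real) f' C. Ck_bounded (Suc k) C h \<Longrightarrow>
        (\<And>t. (f has_vector_derivative f' t) (at t)) \<Longrightarrow> Ck_bounded (Suc k - 1) M f' \<Longrightarrow>
        Ck_bounded (Suc k) (K * C) (\<lambda>t. h (f t))"
      using Ck_bounded_compose[where ?'a = real] by blast
    have "Ck_bounded (Suc k) (K * (1 * C)) (\<lambda>t. - L (G t))"
      by (rule K(2)[OF Ck_bounded_le[OF Suc.prems nL] G]) (use M in simp)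
    then show ?case
      using Ck_bounded_exp[of "Suc k" "K * (1 * C)"] by blast
  qed
  then show ?thesis using that by blast
qed

lemma Ck_real_cis_lift:
  assumes F: "\<And>t. (F has_vector_derivative F' t) (at t)" and F': "Ck_bounded l M F'"
  shows "Ck_real (Suc l) (\<lambda>t. cis (F t))"
proof -
  obtain D where D: "0 \<le> D" "\<And>(E :: real \<Rightarrow> complex) A B. (\<And>t. (E has_vector_derivative A t * E t) (at t)) \<Longrightarrow>
      (\<And>t. norm (E t) \<le> B) \<Longrightarrow> Ck_bounded (Suc l - 1) (1 * M) A \<Longrightarrow> Ck_bounded (Suc l) (D * B) E"
    using Ck_bounded_linear_ode by blast
  have "Ck_bounded (Suc l) (D * 1) (\<lambda>t. cis (F t))"
  proof (rule D(2))
    show "((\<lambda>t. cis (F t)) has_vector_derivative (\<i> * of_real (F' t)) * cis (F t)) (at t)" for t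
      using has_vector_derivative_compose_real[OF F has_vector_derivative_mult_cis[of 1]]
      by (simp add: scaleR_conv_of_real mult_ac)
    show "Ck_bounded (Suc l - 1) (1 * M) (\<lambda>t. \<i> * of_real (F' t))"
      using Ck_bounded_linear[of "\<lambda>x. \<i> * of_real x" 1 l M F'] F'
      by (simp add: bounded_linear_const_mult bounded_linear_of_real norm_mult)
  qed auto
  then show ?thesis by (rule Ck_bounded_imp_Ck_real)
qed

lemma circle_diffeo_if_lift:
  fixes F L :: "real \<Rightarrow> real"
  assumes F: "\<And>t. (F has_vector_derivative exp (L t)) (at t)"
    and per: "\<And>t. F (t + 2 * pi) = F t + 2 * pi"
    and L: "Ck_bounded l C L" and f: "\<And>t. f (cis t) = cis (F t)"
  shows "\<exists>g. homeomorphism (sphere 0 1) (sphere 0 1) f g \<and> circle_orientation_preserving f \<and>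
    circle_Ck (Suc l) f \<and> circle_Ck (Suc l) g"
proof -
  obtain G where mono: "strict_mono F" and FG: "\<And>t. F (G t) = t" and GF: "\<And>t. G (F t) = t"
    and G: "\<And>t. (G has_vector_derivative exp (- L (G t))) (at t)"
    and perG: "\<And>t. G (t + 2 * pi) = G t + 2 * pi"
    using lift_inverse[OF F per] by blast
  define g where "g z = cis (G (Arg z))" for z
  have g: "g (cis t) = cis (G t)" for t
    unfolding g_def by (rule cis_eq_imp_lift_cis_eq[where F = G, OF perG]) (simp add: cis_Arg_sphere)
  note contF = continuous_on_UNIV_if_vector_derivative[OF F]
  note contG = continuous_on_UNIV_if_vector_derivative[OF G]
  have param: "\<exists>t. z = cis t" if "z \<in> sphere 0 1" for z
    using cis_Arg_sphere[OF that] by metis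
  have "homeomorphism (sphere 0 1) (sphere 0 1) f g"
  proof (rule homeomorphismI)
    show "continuous_on (sphere 0 1) f" "continuous_on (sphere 0 1) g"
      using continuous_on_sphere_if_lift[OF contF, of f] continuous_on_sphere_if_lift[OF contG, of g] f g
      by auto
  qed (use param f g FG GF in fastforce)+
  moreover have "circle_orientation_preserving f"
    unfolding circle_orientation_preserving_def using contF mono per f by blast
  moreover have "circle_Ck (Suc l) f"
    unfolding circle_Ck_def f using Ck_bounded_exp[of l C] Ck_real_cis_lift[OF F] L by blast
  moreover have "circle_Ck (Suc l) g"
    unfolding circle_Ck_def g using Ck_bounded_inverse_derivative[OF G L] Ck_real_cis_lift[OF G] by blast
  ultimately show ?thesis by blast
qed

section \<open>Convergence and smoothness of the infinite product\<close>

text \<open>All but finitely many of the numbers are below \<open>1/2\<close>, and the remaining ones have a maximum below \<open>1\<close>.\<close>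

lemma uniform_bound_below_1:
  fixes w :: "nat \<Rightarrow> complex"
  assumes "\<And>n. norm (w n) < 1" "w \<longlonglongrightarrow> 0"
  obtains r where "r < 1" "\<And>n. norm (w n) \<le> r"
proof -
  have "\<forall>\<^sub>F n in sequentially. norm (w n) < 1 / 2"
    using assms(2) tendstoD[of w 0 sequentially "1 / 2"] by simp
  then obtain N where N: "\<And>n. N \<le> n \<Longrightarrow> norm (w n) < 1 / 2"
    by (auto simp: eventually_sequentially)
  define r where "r = Max (insert (1 / 2) ((\<lambda>n. norm (w n)) ` {..<N}))"
  have "r < 1" using assms(1) by (simp add: r_def)
  moreover have "norm (w n) \<le> r" for n
  proof (cases "n < N")
    case False
    then have "norm (w n) \<le> 1 / 2" using N[of n] by simp
    also have "1 / 2 \<le> r" unfolding r_def by (intro Max_ge) auto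
    finally show ?thesis .
  qed (auto simp: r_def intro!: Max_ge)
  ultimately show ?thesis using that by blast
qed

theorem theorem2:
  fixes p :: "nat \<Rightarrow> nat" and w :: "nat \<Rightarrow> complex" and s :: nat
  assumes "bij_betw p {1..} {1..}"
    and "s \<ge> 1"
    and "\<And>n. n \<ge> 1 \<Longrightarrow> norm (w n) < 1"
    and "summable (\<lambda>n. real (Suc n) ^ (s - 1) * norm (w (Suc n)))"
  shows "(\<forall>z\<in>sphere 0 1.
            convergent_prod (\<lambda>n. sigma_factor p w (Suc n) z) \<and>
            (\<lambda>N. sigma_part p w N z) \<longlonglongrightarrow> sigma_lim p w z) \<and>
         (\<exists>g. homeomorphism (sphere 0 1) (sphere 0 1) (sigma_lim p w) g \<and>
            circle_orientation_preserving (sigma_lim p w) \<and>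
            circle_Ck s (sigma_lim p w) \<and> circle_Ck s g)"
proof -
  define m where "m n = p (Suc n)" for n
  define v where "v n = w (m n)" for n
  have m: "1 \<le> m n" for n
    using bij_betwE[OF assms(1)] by (simp add: m_def)
  have Suc_pred_m: "Suc (m n - 1) = m n" for n using m[of n] by simp
  have "summable (\<lambda>n. norm (w (Suc n)))"
  proof (rule summable_comparison_test'[OF assms(4), of 0])
    show "norm (norm (w (Suc n))) \<le> real (Suc n) ^ (s - 1) * norm (w (Suc n))" for n
      using mult_right_mono[OF one_le_power[of "real (Suc n)" "s - 1"], of "norm (w (Suc n))"] by simp
  qed
  then have "(\<lambda>n. w (Suc n)) \<longlonglongrightarrow> 0"
    using summable_LIMSEQ_zero tendsto_norm_zero_iff by blast
  then obtain r where r: "r < 1" "\<And>n. norm (w (Suc n)) \<le> r"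
    using uniform_bound_below_1[of "\<lambda>n. w (Suc n)"] assms(3) by auto
  \<comment> \<open>The series is indexed from \<open>0\<close>, the parameters from \<open>1\<close>; so the rearrangement
     by \<open>p\<close> becomes the reindexing \<open>n \<mapsto> p (n + 1) - 1\<close>.\<close>
  have inj: "inj (\<lambda>n. m n - 1)"
  proof (rule injI)
    fix a b assume "m a - 1 = m b - 1"
    then have "p (Suc a) = p (Suc b)" using Suc_pred_m unfolding m_def by metis
    then show "a = b" using assms(1) by (auto simp: bij_betw_def inj_on_def)
  qed
  have "summable ((\<lambda>n. real (Suc n) ^ (s - 1) * norm (w (Suc n))) \<circ> (\<lambda>n. m n - 1))"
    by (rule summable_reindex[OF assms(4) inj]) auto
  then have summ: "summable (\<lambda>n. real (m n) ^ (s - 1) * norm (v n))"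
    unfolding o_def Suc_pred_m v_def .
  have v: "norm (v n) \<le> r" for n
    using r(2)[of "m n - 1"] by (simp only: Suc_pred_m v_def)
  interpret circle_composition m v r "s - 1"
    by unfold_locales (rule m v r(1) summ)+
  have part: "sigma_part p w N (cis t) = cis (lift_part N t)" for N t
    by (induction N) (simp_all add: phi_cis[OF v_less_1 m_ge_1] flip: m_def v_def)
  have factor: "sigma_factor p w (Suc n) (cis t) = cis (displacement n t)" for n t
    by (simp add: sigma_factor_def part phi_factor_cis[OF v_less_1 m_ge_1] displacement_def flip: m_def v_def)
  have prod: "(\<lambda>n. sigma_factor p w (Suc n) (cis t)) has_prod cis (\<Sum>n. displacement n t)" for t
  proof -
    have "(\<Prod>i\<le>n. cis (displacement i t)) = cis (\<Sum>i\<le>n. displacement i t)" for n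
      by (induction n) (auto simp: cis_mult)
    moreover have "(\<lambda>n. cis (\<Sum>i\<le>n. displacement i t)) \<longlonglongrightarrow> cis (\<Sum>n. displacement n t)"
      by (intro tendsto_intros summable_LIMSEQ' summable_displacement)
    ultimately show ?thesis
      by (simp add: has_prod_def raw_has_prod_def factor)
  qed
  have lim: "sigma_lim p w (cis t) = cis (lift_lim t)" for t
    unfolding sigma_lim_def has_prod_unique[OF prod, symmetric] by (simp add: lift_lim_def cis_mult)
  have "convergent_prod (\<lambda>n. sigma_factor p w (Suc n) z) \<and>
      (\<lambda>N. sigma_part p w N z) \<longlonglongrightarrow> sigma_lim p w z" if on_circle: "z \<in> sphere 0 1" for z
  proof -
    obtain t where z: "z = cis t" using cis_Arg_sphere[OF on_circle] by metis
    have "convergent_prod (\<lambda>n. sigma_factor p w (Suc n) z)"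
      using prod[of t] by (auto simp: z has_prod_iff)
    moreover have "(\<lambda>N. cis (lift_part N t)) \<longlonglongrightarrow> cis (lift_lim t)"
      by (intro tendsto_intros lift_part_tendsto)
    ultimately show ?thesis by (simp add: z part lim)
  qed
  moreover obtain C where C: "Ck_bounded (s - 1) C log_deriv"
    using Ck_bounded_log_deriv by blast
  ultimately show ?thesis
    using circle_diffeo_if_lift[where F = lift_lim and L = log_deriv and f = "sigma_lim p w",
        OF lift_lim_has_derivative lift_lim_periodic C lim] assms(2) by simp
qed

end
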